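(* Assume that for every $y\in\mathcal Y$ the function $f(\cdot,y)$ is $\theta$-strongly convex on $\mathcal X$ (no concavity of $f(x,\cdot)$ is assumed) and that $f$ satisfies the Lipschitz gradient assumption with constants $L_{11},L_{12},L_{21},L_{22}>0$. Let $\zeta,\nu>0$ and let $\{(x_k,y_k)\}_{k\ge1}$ be generated from $(x_1,y_1)\in\mathcal X\times\mathcal Y$ by $$x_{k+1}=\mathcal P_{\mathcal X}\big(x_k-\zeta\nabla_xf(x_k,y_k)\big),\qquad y_{k+1}=\mathcal P_{\mathcal Y}\big(y_k+\tfrac1\nu\nabla_yf(x_{k+1},y_k)\big),\quad k\ge1.$$ If $\nu>L_{22}$, then for all $k\ge2$, $$f(x_{k+1},y_{k+1})-f(x_k,y_k)\ge\frac\nu2\|y_{k+1}-y_k\|^2-\frac{L_{21}^2\zeta}{2}\|y_k-y_{k-1}\|^2+\Big(\theta-\frac1{2\zeta}-\frac{\zeta L_{11}^2}{2}\Big)\|x_k-x_{k-1}\|^2+\Big(\frac\theta2-\frac1\zeta\Big)\|x_{k+1}-x_k\|^2 .$$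
   Context: $\mathcal X\subseteq\mathbb R^n$ and $\mathcal Y\subseteq\mathbb R^m$ are nonempty closed bounded convex sets and $f:\mathcal X\times\mathcal Y\to\mathbb R$ is a smooth function. $\|\cdot\|$ is the Euclidean norm; $\mathcal P_{\mathcal X},\mathcal P_{\mathcal Y}$ are Euclidean projections. Lipschitz gradient assumption: for all $x,\bar x\in\mathcal X$, $y,\bar y\in\mathcal Y$: $\|\nabla_xf(x,y)-\nabla_xf(\bar x,y)\|\le L_{11}\|x-\bar x\|$, $\|\nabla_xf(x,y)-\nabla_xf(x,\bar y)\|\le L_{21}\|y-\bar y\|$, $\|\nabla_yf(x,y)-\nabla_yf(x,\bar y)\|\le L_{22}\|y-\bar y\|$, $\|\nabla_yf(x,y)-\nabla_yf(\bar x,y)\|\le L_{12}\|x-\bar x\|$. A continuously differentiable $\phi$ is $\theta$-strongly convex ($\theta>0$) if $\phi(v)\ge\phi(u)+\langle\nabla\phi(u),v-u\rangle+\frac\theta2\|v-u\|^2$ for all $u,v$. *)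

theory Defs
  imports "HOL-Analysis.Analysis"
begin

(* Continuous differentiability on a set S (typically closed and convex), with gradient field g.
   The derivative is taken within S, so only the values of phi on S matter. If S has empty
   interior, phi alone does not determine g; the gradient of any continuously differentiable
   extension of phi to a neighbourhood of S is an admissible g. *)
definition C1_with_gradient_on ::
  "'a::euclidean_space set \<Rightarrow> ('a \<Rightarrow> real) \<Rightarrow> ('a \<Rightarrow> 'a) \<Rightarrow> bool" where
  "C1_with_gradient_on S \<phi> g \<longleftrightarrow>
     (\<forall>u\<in>S. (\<phi> has_derivative (\<lambda>h. g u \<bullet> h)) (at u within S)) \<and> continuous_on S g"

definition strongly_convex_on ::
  "real \<Rightarrow> 'a::euclidean_space set \<Rightarrow> ('a \<Rightarrow> real) \<Rightarrow> ('a \<Rightarrow> 'a) \<Rightarrow> bool" where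
  "strongly_convex_on \<theta> S \<phi> g \<longleftrightarrow>
     \<theta> > 0 \<and> C1_with_gradient_on S \<phi> g \<and>
     (\<forall>u\<in>S. \<forall>v\<in>S. \<phi> v \<ge> \<phi> u + g u \<bullet> (v - u) + \<theta> / 2 * (norm (v - u))\<^sup>2)"

(* gx and gy are the two partial gradients of a function on X \<times> Y. *)
definition Lipschitz_gradients ::
  "'a::euclidean_space set \<Rightarrow> 'b::euclidean_space set \<Rightarrow> ('a \<times> 'b \<Rightarrow> 'a) \<Rightarrow> ('a \<times> 'b \<Rightarrow> 'b) \<Rightarrow>
   real \<Rightarrow> real \<Rightarrow> real \<Rightarrow> real \<Rightarrow> bool" where
  "Lipschitz_gradients X Y gx gy L11 L12 L21 L22 \<longleftrightarrow>
     (\<forall>x\<in>X. \<forall>x'\<in>X. \<forall>y\<in>Y. \<forall>y'\<in>Y.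
        norm (gx (x, y) - gx (x', y)) \<le> L11 * norm (x - x') \<and>
        norm (gx (x, y) - gx (x, y')) \<le> L21 * norm (y - y') \<and>
        norm (gy (x, y) - gy (x, y')) \<le> L22 * norm (y - y') \<and>
        norm (gy (x, y) - gy (x', y)) \<le> L12 * norm (x - x'))"

end

theory Submission
  imports Defs
begin

text \<open>
  The ascent step is handled by the quadratic lower bound for a function with Lipschitz gradient.
  For the descent step, strong convexity at \<open>x\<^sub>k\<close> leaves \<open>\<nabla>\<^sub>x f(x\<^sub>k, y\<^sub>k) \<bullet> (x\<^sub>k\<^sub>+\<^sub>1 - x\<^sub>k)\<close> to be bounded
  below. The projection defining \<open>x\<^sub>k\<close> (not \<open>x\<^sub>k\<^sub>+\<^sub>1\<close>) is tested against \<open>x\<^sub>k\<^sub>+\<^sub>1\<close>, and the remaining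
  gradient difference is split at \<open>(x\<^sub>k, y\<^sub>k\<^sub>-\<^sub>1)\<close> and estimated by Young's inequality and strong
  monotonicity.
\<close>

text \<open>The mean value theorem is applied along the segment from \<open>u\<close> to
  \<open>v\<close>, where the Lipschitz bound at the base point \<open>u\<close> controls how fast
  the gradient can turn against \<open>v - u\<close>.\<close>

lemma quadratic_lower_bound:
  fixes g :: "'a::real_inner \<Rightarrow> 'a"
  assumes S: "convex S" "u \<in> S" "v \<in> S"
    and deriv: "\<And>w. w \<in> S \<Longrightarrow> (\<phi> has_derivative (\<lambda>h. g w \<bullet> h)) (at w within S)"
    and lip: "\<And>w. w \<in> S \<Longrightarrow> norm (g w - g u) \<le> L * norm (w - u)"
  shows "\<phi> v \<ge> \<phi> u + g u \<bullet> (v - u) - L / 2 * (norm (v - u))\<^sup>2"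
proof -
  define d where "d = v - u"
  \<comment> \<open>\<open>\<psi> 1 - \<psi> 0\<close> is exactly the gap between the two sides of
    the claim, so one point with \<open>\<psi>' t \<ge> 0\<close> suffices.\<close>
  define \<psi> where "\<psi> t = \<phi> (u + t *\<^sub>R d) - t * (g u \<bullet> d) + L / 2 * t\<^sup>2 * (norm d)\<^sup>2" for t
  define \<psi>' where "\<psi>' t = (g (u + t *\<^sub>R d) - g u) \<bullet> d + L * t * (norm d)\<^sup>2" for t
  have seg: "u + t *\<^sub>R d \<in> S" if "t \<in> {0..1}" for t
  proof -
    have "u + t *\<^sub>R d = (1 - t) *\<^sub>R u + t *\<^sub>R v"
      by (simp add: d_def algebra_simps)
    then show ?thesis
      using S that by (auto intro: convexD)
  qed
  have "(\<psi> has_derivative (\<lambda>h. \<psi>' t * h)) (at t within {0..1})" if t: "t \<in> {0..1}" for t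
  proof -
    have line: "((\<lambda>t. u + t *\<^sub>R d) has_derivative (\<lambda>h. h *\<^sub>R d)) (at t within {0..1})"
      by (auto intro!: derivative_eq_intros)
    have "((\<lambda>t. \<phi> (u + t *\<^sub>R d)) has_derivative (\<lambda>h. g (u + t *\<^sub>R d) \<bullet> (h *\<^sub>R d)))
            (at t within {0..1})"
      by (rule has_derivative_in_compose2[OF deriv _ t line]) (use seg in auto)
    then show ?thesis
      unfolding \<psi>_def \<psi>'_def
      by (auto intro!: derivative_eq_intros simp: fun_eq_iff algebra_simps)
  qed
  then obtain t where t: "t \<in> {0..1}" and mvt: "\<psi> 1 - \<psi> 0 = \<psi>' t"
    using mvt_very_simple[of 0 1 \<psi> "\<lambda>t h. \<psi>' t * h"] by auto
  \<comment> \<open>The derivative \<open>L * t * (norm d)\<^sup>2\<close> of the quadratic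
    correction offsets the worst case allowed by Cauchy-Schwarz and the Lipschitz bound.\<close>
  have "\<bar>(g (u + t *\<^sub>R d) - g u) \<bullet> d\<bar> \<le> norm (g (u + t *\<^sub>R d) - g u) * norm d"
    by (rule Cauchy_Schwarz_ineq2)
  also have "\<dots> \<le> (L * norm (t *\<^sub>R d)) * norm d"
    using lip[OF seg[OF t]] by (intro mult_right_mono) auto
  also have "\<dots> = L * t * (norm d)\<^sup>2"
    using t by (simp add: power2_eq_square)
  finally have "\<psi>' t \<ge> 0"
    by (simp add: \<psi>'_def)
  with mvt show ?thesis
    by (simp add: \<psi>_def d_def)
qed

text \<open>Expand the square of \<open>\<zeta> *\<^sub>R a + b\<close>. The weight is the step
  size, so that \<open>1 / (2 * \<zeta>)\<close> matches the terms produced by the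
  projection.\<close>

lemma Young_inner_lower_bound:
  fixes a b :: "'a::real_inner"
  assumes "\<zeta> > 0"
  shows "a \<bullet> b \<ge> - (\<zeta> / 2 * (norm a)\<^sup>2) - 1 / (2 * \<zeta>) * (norm b)\<^sup>2"
proof -
  have "0 \<le> (norm (\<zeta> *\<^sub>R a + b))\<^sup>2 / (2 * \<zeta>)"
    using assms by simp
  also have "\<dots> = a \<bullet> b + \<zeta> / 2 * (norm a)\<^sup>2 + 1 / (2 * \<zeta>) * (norm b)\<^sup>2"
    using assms unfolding power2_norm_eq_inner
    by (simp add: inner_add inner_commute field_simps power2_eq_square)
  finally show ?thesis
    by simp
qed

text \<open>This is the variational inequality of the projection, rearranged. The sign of
  \<open>c\<close> is free, so it serves both the descent step (\<open>c = - \<zeta>\<close>) and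
  the ascent step (\<open>c = 1 / \<nu>\<close>).\<close>

lemma closest_point_step_inner:
  fixes u g :: "'a::euclidean_space"
  assumes "convex S" "closed S" "v \<in> S" "p = closest_point S (u + c *\<^sub>R g)"
  shows "c * (g \<bullet> (v - p)) \<le> (p - u) \<bullet> (v - p)"
  using closest_point_dot[OF assms(1-3), of "u + c *\<^sub>R g"] assms(4)
  by (simp add: algebra_simps inner_simps)

text \<open>Adding the strong convexity inequalities at \<open>u\<close> and at \<open>v\<close>
  cancels the function values, and the two halves of \<open>\<theta>\<close> combine.\<close>

lemma strongly_convex_on_monotone:
  assumes "strongly_convex_on \<theta> S \<phi> g" "u \<in> S" "v \<in> S"
  shows "(g v - g u) \<bullet> (v - u) \<ge> \<theta> * (norm (v - u))\<^sup>2"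
proof -
  have "\<phi> v \<ge> \<phi> u + g u \<bullet> (v - u) + \<theta> / 2 * (norm (v - u))\<^sup>2"
    and "\<phi> u \<ge> \<phi> v + g v \<bullet> (u - v) + \<theta> / 2 * (norm (v - u))\<^sup>2"
    using assms by (auto simp: strongly_convex_on_def norm_minus_commute)
  then show ?thesis
    by (simp add: inner_simps algebra_simps)
qed

theorem lemma4p1:
  fixes X :: "(real ^ 'n) set" and Y :: "(real ^ 'm) set"
    and f :: "(real ^ 'n) \<times> (real ^ 'm) \<Rightarrow> real"
    and gx :: "(real ^ 'n) \<times> (real ^ 'm) \<Rightarrow> real ^ 'n"
    and gy :: "(real ^ 'n) \<times> (real ^ 'm) \<Rightarrow> real ^ 'm"
    and x :: "nat \<Rightarrow> real ^ 'n" and y :: "nat \<Rightarrow> real ^ 'm"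
    and \<theta> \<zeta> \<nu> L11 L12 L21 L22 :: real
  assumes "X \<noteq> {}" and "closed X" and "bounded X" and "convex X"
    and "Y \<noteq> {}" and "closed Y" and "bounded Y" and "convex Y"
    and "C1_with_gradient_on (X \<times> Y) f (\<lambda>z. (gx z, gy z))"
    and "\<theta> > 0"
    and "\<And>v. v \<in> Y \<Longrightarrow> strongly_convex_on \<theta> X (\<lambda>u. f (u, v)) (\<lambda>u. gx (u, v))"
    and "L11 > 0" and "L12 > 0" and "L21 > 0" and "L22 > 0"
    and "Lipschitz_gradients X Y gx gy L11 L12 L21 L22"
    and "\<zeta> > 0" and "\<nu> > 0"
    and "x 1 \<in> X" and "y 1 \<in> Y"
    and "\<And>k. k \<ge> 1 \<Longrightarrow> x (k + 1) = closest_point X (x k - \<zeta> *\<^sub>R gx (x k, y k))"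
    and "\<And>k. k \<ge> 1 \<Longrightarrow> y (k + 1) = closest_point Y (y k + (1 / \<nu>) *\<^sub>R gy (x (k + 1), y k))"
    and "\<nu> > L22"
  shows "\<forall>k\<ge>2. f (x (k + 1), y (k + 1)) - f (x k, y k) \<ge>
      \<nu> / 2 * (norm (y (k + 1) - y k))\<^sup>2
      - L21\<^sup>2 * \<zeta> / 2 * (norm (y k - y (k - 1)))\<^sup>2
      + (\<theta> - 1 / (2 * \<zeta>) - \<zeta> * L11\<^sup>2 / 2) * (norm (x k - x (k - 1)))\<^sup>2
      + (\<theta> / 2 - 1 / \<zeta>) * (norm (x (k + 1) - x k))\<^sup>2"
proof (intro allI impI)
  note closed = \<open>closed X\<close> \<open>closed Y\<close>
    and convex = \<open>convex X\<close> \<open>convex Y\<close>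
    and sc = assms(11)
    and x_step = assms(21) and y_step = assms(22)
    and pos = \<open>\<zeta> > 0\<close> \<open>\<nu> > 0\<close>
  have in_X: "x j \<in> X" if "j \<ge> 1" for j
    using that
    by (induction j rule: dec_induct)
      (use \<open>x 1 \<in> X\<close> x_step closest_point_in_set[OF \<open>closed X\<close> \<open>X \<noteq> {}\<close>] in auto)
  have in_Y: "y j \<in> Y" if "j \<ge> 1" for j
    using that
    by (induction j rule: dec_induct)
      (use \<open>y 1 \<in> Y\<close> y_step closest_point_in_set[OF \<open>closed Y\<close> \<open>Y \<noteq> {}\<close>] in auto)
  fix k :: nat
  assume k: "k \<ge> 2"
  \<comment> \<open>Since \<open>k - 1 \<ge> 1\<close>, \<open>x0\<close> and \<open>y0\<close> are
    genuine iterates and \<open>x1\<close> is itself the result of a projection step.\<close>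
  define x0 x1 x2 where "x0 = x (k - 1)" and "x1 = x k" and "x2 = x (k + 1)"
  define y0 y1 y2 where "y0 = y (k - 1)" and "y1 = y k" and "y2 = y (k + 1)"
  note defs = x0_def x1_def x2_def y0_def y1_def y2_def
  have X: "x0 \<in> X" "x1 \<in> X" "x2 \<in> X" and Y: "y0 \<in> Y" "y1 \<in> Y" "y2 \<in> Y"
    using k by (auto simp: defs intro!: in_X in_Y)
  have x1: "x1 = closest_point X (x0 + (- \<zeta>) *\<^sub>R gx (x0, y0))"
    using x_step[of "k - 1"] k by (simp add: defs)
  have y2: "y2 = closest_point Y (y1 + (1 / \<nu>) *\<^sub>R gy (x2, y1))"
    using y_step[of k] k by (simp add: defs)

  \<comment> \<open>The total change is split at \<open>(x2, y1)\<close>, because the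
    \<open>y\<close> update uses the gradient at the already updated \<open>x2\<close>.\<close>
  have ascent: "f (x2, y2) - f (x2, y1) \<ge> \<nu> / 2 * (norm (y2 - y1))\<^sup>2"
  proof -
    have deriv: "((\<lambda>v. f (x2, v)) has_derivative (\<lambda>h. gy (x2, w) \<bullet> h)) (at w within Y)"
      if "w \<in> Y" for w
    proof -
      have f: "(f has_derivative (\<lambda>h. (gx z, gy z) \<bullet> h)) (at z within X \<times> Y)"
        if "z \<in> X \<times> Y" for z
        using assms(9) that unfolding C1_with_gradient_on_def by blast
      have inj: "(Pair x2 has_derivative (\<lambda>h. (0, h))) (at w within Y)"
        by (auto intro!: derivative_eq_intros)
      have "((\<lambda>v. f (x2, v)) has_derivative (\<lambda>h. (gx (x2, w), gy (x2, w)) \<bullet> (0, h)))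
          (at w within Y)"
        by (rule has_derivative_in_compose2[OF f _ that inj]) (use X in auto)
      then show ?thesis
        by (simp add: inner_Pair)
    qed
    have lip: "norm (gy (x2, w) - gy (x2, y1)) \<le> L22 * norm (w - y1)" if "w \<in> Y" for w
      using assms(16) X Y that unfolding Lipschitz_gradients_def by blast
    have "f (x2, y2) \<ge> f (x2, y1) + gy (x2, y1) \<bullet> (y2 - y1) - L22 / 2 * (norm (y2 - y1))\<^sup>2"
      by (rule quadratic_lower_bound[OF convex(2) Y(2) Y(3) deriv lip])
    \<comment> \<open>Testing the projection \<open>y2\<close> against \<open>y1\<close> gains
      \<open>\<nu>\<close>; the quadratic bound loses \<open>L22 / 2\<close>, which is below
      \<open>\<nu> / 2\<close>.\<close>
    moreover have "gy (x2, y1) \<bullet> (y2 - y1) \<ge> \<nu> * (norm (y2 - y1))\<^sup>2"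
      using closest_point_step_inner[OF convex(2) closed(2) Y(2) y2] pos
      by (simp add: power2_norm_eq_inner inner_simps field_simps)
    moreover have "L22 * (norm (y2 - y1))\<^sup>2 \<le> \<nu> * (norm (y2 - y1))\<^sup>2"
      using \<open>\<nu> > L22\<close> by (intro mult_right_mono) auto
    ultimately show ?thesis
      by simp
  qed

  have descent: "f (x2, y1) - f (x1, y1) \<ge>
      - (L21\<^sup>2 * \<zeta> / 2 * (norm (y1 - y0))\<^sup>2)
      + (\<theta> - 1 / (2 * \<zeta>) - \<zeta> * L11\<^sup>2 / 2) * (norm (x1 - x0))\<^sup>2
      + (\<theta> / 2 - 1 / \<zeta>) * (norm (x2 - x1))\<^sup>2"
  proof -
    define d e where "d = x1 - x0" and "e = x2 - x1"
    define D E where "D = gx (x1, y0) - gx (x0, y0)" and "E = gx (x1, y1) - gx (x1, y0)"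
    have lip: "norm D \<le> L11 * norm d" "norm E \<le> L21 * norm (y1 - y0)"
      using assms(16) X Y unfolding Lipschitz_gradients_def D_def E_def d_def by blast+
    have D: "(norm D)\<^sup>2 \<le> L11\<^sup>2 * (norm d)\<^sup>2" and E: "(norm E)\<^sup>2 \<le> L21\<^sup>2 * (norm (y1 - y0))\<^sup>2"
      using lip[THEN power_mono[where n = 2]] by (simp_all add: power_mult_distrib)
    have "- \<zeta> * (gx (x0, y0) \<bullet> e) \<le> d \<bullet> e"
      using closest_point_step_inner[OF convex(1) closed(1) X(3) x1] by (simp add: d_def e_def)
    then have opt: "gx (x0, y0) \<bullet> e \<ge> - (1 / \<zeta> * (d \<bullet> e))"
      using pos by (simp add: field_simps)
    have "E \<bullet> e \<ge> - (\<zeta> / 2 * (L21\<^sup>2 * (norm (y1 - y0))\<^sup>2)) - 1 / (2 * \<zeta>) * (norm e)\<^sup>2"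
      using Young_inner_lower_bound[OF pos(1), of E e] mult_left_mono[OF E, of "\<zeta> / 2"] pos
      by linarith
    \<comment> \<open>\<open>D \<bullet> e\<close> is split as
      \<open>D \<bullet> (e - d) + D \<bullet> d\<close>: the second part earns
      \<open>\<theta>\<close> by monotonicity, and the cross term in
      \<open>(norm (e - d))\<^sup>2\<close> cancels the \<open>1 / \<zeta> * (d \<bullet> e)\<close>
      of \<open>opt\<close>.\<close>
    moreover have "D \<bullet> (e - d) \<ge> - (\<zeta> / 2 * (L11\<^sup>2 * (norm d)\<^sup>2)) - 1 / (2 * \<zeta>) * (norm (e - d))\<^sup>2"
      using Young_inner_lower_bound[OF pos(1), of D "e - d"] mult_left_mono[OF D, of "\<zeta> / 2"] pos
      by linarith
    moreover have "D \<bullet> d \<ge> \<theta> * (norm d)\<^sup>2"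
      using strongly_convex_on_monotone[OF sc[OF Y(1)] X(1) X(2)] by (simp add: D_def d_def)
    moreover have "gx (x1, y1) \<bullet> e = gx (x0, y0) \<bullet> e + E \<bullet> e + D \<bullet> (e - d) + D \<bullet> d"
      by (simp add: D_def E_def inner_simps)
    moreover have "1 / (2 * \<zeta>) * (norm (e - d))\<^sup>2
        = 1 / (2 * \<zeta>) * (norm e)\<^sup>2 + 1 / (2 * \<zeta>) * (norm d)\<^sup>2 - 1 / \<zeta> * (d \<bullet> e)"
      using pos by (simp add: power2_norm_eq_inner inner_simps inner_commute field_simps)
    moreover have "f (x2, y1) \<ge> f (x1, y1) + gx (x1, y1) \<bullet> e + \<theta> / 2 * (norm e)\<^sup>2"
      using sc[OF Y(2)] X unfolding strongly_convex_on_def e_def by blast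
    \<comment> \<open>The loss \<open>1 / \<zeta>\<close> consists of two halves, one from Young's
      inequality for \<open>E\<close> and one from expanding
      \<open>(norm (e - d))\<^sup>2\<close>.\<close>
    moreover have "(\<theta> / 2 - 1 / \<zeta>) * (norm e)\<^sup>2
        = \<theta> / 2 * (norm e)\<^sup>2 - 1 / (2 * \<zeta>) * (norm e)\<^sup>2 - 1 / (2 * \<zeta>) * (norm e)\<^sup>2"
      using pos by (simp add: field_simps)
    moreover have "(\<theta> - 1 / (2 * \<zeta>) - \<zeta> * L11\<^sup>2 / 2) * (norm d)\<^sup>2
        = \<theta> * (norm d)\<^sup>2 - 1 / (2 * \<zeta>) * (norm d)\<^sup>2 - \<zeta> / 2 * (L11\<^sup>2 * (norm d)\<^sup>2)"
      by (simp add: algebra_simps)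
    moreover have "L21\<^sup>2 * \<zeta> / 2 * (norm (y1 - y0))\<^sup>2 = \<zeta> / 2 * (L21\<^sup>2 * (norm (y1 - y0))\<^sup>2)"
      by simp
    ultimately show ?thesis
      using opt unfolding d_def[symmetric] e_def[symmetric] by linarith
  qed

  show "f (x (k + 1), y (k + 1)) - f (x k, y k) \<ge>
      \<nu> / 2 * (norm (y (k + 1) - y k))\<^sup>2
      - L21\<^sup>2 * \<zeta> / 2 * (norm (y k - y (k - 1)))\<^sup>2
      + (\<theta> - 1 / (2 * \<zeta>) - \<zeta> * L11\<^sup>2 / 2) * (norm (x k - x (k - 1)))\<^sup>2
      + (\<theta> / 2 - 1 / \<zeta>) * (norm (x (k + 1) - x k))\<^sup>2"
    using ascent descent unfolding defs by linarith
qed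

end
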